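(* Let $\omega$ be chosen uniformly at random from the set $\Omega_n$ of all equi-$n$-squares. Then, as $n\to\infty$, the probability that $\omega$ is a consecutive equi-$n$-square satisfies $$P(\omega\in\Sigma_n)\sim\frac{4n^{n+1}\,(n^2-n)!}{(n^2)!},$$ i.e. the ratio of the two sides tends to $1$.
   Context: An equi-$n$-square is an $n\times n$ array with entries in $\{1,\dots,n\}$ in which each symbol $1,\dots,n$ occurs exactly $n$ times in the whole array; $\Omega_n$ is the set of all equi-$n$-squares. A row (read left to right) or column (read top to bottom) is called consecutive if it equals $(1,2,\dots,n)$ or $(n,n-1,\dots,1)$. An equi-$n$-square is called consecutive if at least one of its rows or columns is consecutive; $\Sigma_n\subseteq\Omega_n$ is the set of all consecutive equi-$n$-squares. *)

theory Defs
  imports "HOL-Probability.Probability" "HOL-Library.Landau_Symbols"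
begin

(* An n x n array A is an extensional function on {1..n} x {1..n}; A (i, j) is the entry
   in row i and column j.  Extensionality makes distinct functions distinct arrays, so that
   the set of equi-n-squares is finite and counted correctly. *)
definition equi_squares :: "nat \<Rightarrow> (nat \<times> nat \<Rightarrow> nat) set" where
  "equi_squares n =
     {A \<in> ({1..n} \<times> {1..n}) \<rightarrow>\<^sub>E {1..n}.
        \<forall>s\<in>{1..n}. card {p \<in> {1..n} \<times> {1..n}. A p = s} = n}"

definition square_row :: "nat \<Rightarrow> (nat \<times> nat \<Rightarrow> nat) \<Rightarrow> nat \<Rightarrow> nat list" where
  "square_row n A i = map (\<lambda>j. A (i, j)) [1..<Suc n]"

definition square_col :: "nat \<Rightarrow> (nat \<times> nat \<Rightarrow> nat) \<Rightarrow> nat \<Rightarrow> nat list" where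
  "square_col n A j = map (\<lambda>i. A (i, j)) [1..<Suc n]"

definition consecutive_line :: "nat \<Rightarrow> nat list \<Rightarrow> bool" where
  "consecutive_line n xs \<longleftrightarrow> xs = [1..<Suc n] \<or> xs = rev [1..<Suc n]"

definition consecutive_squares :: "nat \<Rightarrow> (nat \<times> nat \<Rightarrow> nat) set" where
  "consecutive_squares n =
     {A \<in> equi_squares n.
        (\<exists>i\<in>{1..n}. consecutive_line n (square_row n A i)) \<or>
        (\<exists>j\<in>{1..n}. consecutive_line n (square_col n A j))}"

end

theory Submission
  imports Defs "HOL-Real_Asymp.Real_Asymp"
begin

(* There are 4n events "a given line is consecutive in a given direction".  Each has
   probability exactly n^n (n^2 - n)! / (n^2)! by multinomial counting.  Once one of them
   occurs, a second one prescribes at least n - 1 further cells with distinct symbols, which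
   has conditional probability at most (n - 1)^(-(n - 1)).  The union bound and the first
   Bonferroni inequality therefore agree up to a factor 1 - 4n (n - 1)^(-(n - 1)). *)

section \<open>Functions with prescribed fibre sizes\<close>

text \<open>The multiplicity may depend on the symbol: prescribing some cells uses up copies only of
  the symbols placed there, so this class stays closed under deleting prescribed cells.\<close>

definition fibre_funs :: "'a set \<Rightarrow> 'b set \<Rightarrow> ('b \<Rightarrow> nat) \<Rightarrow> ('a \<Rightarrow> 'b) set" where
  "fibre_funs S T c = {A \<in> S \<rightarrow>\<^sub>E T. \<forall>s\<in>T. card {p \<in> S. A p = s} = c s}"

lemma finite_fibre_funs: "finite S \<Longrightarrow> finite T \<Longrightarrow> finite (fibre_funs S T c)"
  unfolding fibre_funs_def by (rule finite_subset[OF _ finite_PiE[of S "\<lambda>_. T"]]) auto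

lemma fibre_funs_cong: "(\<And>s. s \<in> T \<Longrightarrow> c s = d s) \<Longrightarrow> fibre_funs S T c = fibre_funs S T d"
  by (auto simp: fibre_funs_def)

lemma card_fibre_split:
  assumes "finite S" "L \<subseteq> S"
  shows "card {p \<in> S. A p = s} = card {p \<in> L. A p = s} + card {p \<in> S - L. A p = s}"
proof -
  have "{p \<in> S. A p = s} = {p \<in> L. A p = s} \<union> {p \<in> S - L. A p = s}"
    using assms by auto
  moreover have "finite {p \<in> L. A p = s}" "finite {p \<in> S - L. A p = s}"
    using assms by (auto intro: finite_subset)
  ultimately show ?thesis
    by (simp add: card_Un_disjoint disjoint_iff)
qed

lemma card_fibre_inj_on:
  assumes "inj_on g L"
  shows "card {p \<in> L. g p = s} = (if s \<in> g ` L then 1 else 0)"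
proof (cases "s \<in> g ` L")
  case True
  then obtain p where "p \<in> L" "g p = s" by auto
  then have "{p \<in> L. g p = s} = {p}" using assms by (auto dest: inj_onD)
  then show ?thesis using True by simp
next
  case False
  then have "{p \<in> L. g p = s} = {}" by auto
  then show ?thesis using False by (simp only: if_False card.empty)
qed

text \<open>Deleting cells whose entries are known loses no information, and pasting
  \<open>g\<close> back is the inverse. The bound on the fibres of \<open>g\<close> makes the
  natural subtraction exact, so that pasting restores the multiplicities \<open>c\<close>.\<close>

lemma bij_betw_fibre_funs_restrict:
  assumes S: "finite S" "L \<subseteq> S" and g: "g \<in> L \<rightarrow> T"
    and le: "\<And>s. s \<in> T \<Longrightarrow> card {p \<in> L. g p = s} \<le> c s"
  shows "bij_betw (\<lambda>A. restrict A (S - L)) {A \<in> fibre_funs S T c. \<forall>p\<in>L. A p = g p}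
           (fibre_funs (S - L) T (\<lambda>s. c s - card {p \<in> L. g p = s}))"
\<comment> \<open>The cases are, in order: pasting undoes restriction, restriction undoes pasting,
  restriction lands in the smaller class, pasting lands in the larger one.\<close>
proof (rule bij_betw_byWitness[where f' = "\<lambda>B p. if p \<in> L then g p else B p"], goal_cases)
  case 1
  have "(\<lambda>p. if p \<in> L then g p else restrict A (S - L) p) = A"
    if "A \<in> fibre_funs S T c" "\<forall>p\<in>L. A p = g p" for A
    using that S by (intro ext) (auto simp: fibre_funs_def PiE_def extensional_def)
  then show ?case by blast
next
  case 2
  have "restrict (\<lambda>p. if p \<in> L then g p else B p) (S - L) = B"
    if "B \<in> fibre_funs (S - L) T (\<lambda>s. c s - card {p \<in> L. g p = s})" for B
    using that by (intro ext) (auto simp: fibre_funs_def PiE_def extensional_def)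
  then show ?case by blast
next
  case 3
  have "restrict A (S - L) \<in> fibre_funs (S - L) T (\<lambda>s. c s - card {p \<in> L. g p = s})"
    if A: "A \<in> fibre_funs S T c" "\<forall>p\<in>L. A p = g p" for A
  proof -
    have "card {p \<in> S - L. restrict A (S - L) p = s} = c s - card {p \<in> L. g p = s}"
      if "s \<in> T" for s
    proof -
      have "{p \<in> S - L. restrict A (S - L) p = s} = {p \<in> S - L. A p = s}" by auto
      moreover have "{p \<in> L. A p = s} = {p \<in> L. g p = s}" using A by auto
      moreover have "card {p \<in> S. A p = s} = c s"
        using A that by (simp add: fibre_funs_def)
      ultimately show ?thesis using card_fibre_split[OF S, of A s] by simp
    qed
    then show ?thesis using A by (auto simp: fibre_funs_def)
  qed
  then show ?case by auto
next
  case 4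
  have "(\<lambda>p. if p \<in> L then g p else B p) \<in> fibre_funs S T c"
    if B: "B \<in> fibre_funs (S - L) T (\<lambda>s. c s - card {p \<in> L. g p = s})" for B
  proof -
    let ?A = "\<lambda>p. if p \<in> L then g p else B p"
    have "card {p \<in> S. ?A p = s} = c s" if "s \<in> T" for s
    proof -
      have "{p \<in> S - L. ?A p = s} = {p \<in> S - L. B p = s}" by auto
      moreover have "{p \<in> L. ?A p = s} = {p \<in> L. g p = s}" by auto
      moreover have "card {p \<in> S - L. B p = s} = c s - card {p \<in> L. g p = s}"
        using B that by (simp add: fibre_funs_def)
      ultimately show ?thesis
        using card_fibre_split[OF S, of ?A s] le[OF that] by simp
    qed
    moreover have "?A \<in> S \<rightarrow>\<^sub>E T"
      using B S g by (auto simp: fibre_funs_def PiE_def extensional_def Pi_iff)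
    ultimately show ?thesis by (simp add: fibre_funs_def)
  qed
  then show ?case by auto
qed

text \<open>The multinomial coefficient, with denominators cleared to stay in the naturals.
  Induction on the cells: giving the new cell the symbol \<open>t\<close> leaves the same problem
  with one copy of \<open>t\<close> fewer.\<close>

lemma card_fibre_funs:
  fixes S :: "'a set" and T :: "'b set"
  assumes "finite T" "finite S" "sum c T = card S"
  shows "card (fibre_funs S T c) * (\<Prod>s\<in>T. fact (c s)) = fact (card S)"
  using assms(2,3)
proof (induction S arbitrary: c rule: finite_induct)
  case empty
  then have "c s = 0" if "s \<in> T" for s using that assms(1) by simp
  then have "fibre_funs ({} :: 'a set) T c = {\<lambda>_. undefined}" "(\<Prod>s\<in>T. fact (c s)) = (1::nat)"
    by (auto simp: fibre_funs_def)
  then show ?case by simp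
next
  case (insert x S)
  let ?F = "fibre_funs (insert x S) T c"
  have "?F = (\<Union>t\<in>T. {A \<in> ?F. A x = t})"
    by (auto simp: fibre_funs_def)
  moreover have "card (\<Union>t\<in>T. {A \<in> ?F. A x = t}) = (\<Sum>t\<in>T. card {A \<in> ?F. A x = t})"
    using assms(1) insert.hyps finite_fibre_funs[of "insert x S" T c]
    by (intro card_UN_disjoint) auto
  ultimately have split: "card ?F = (\<Sum>t\<in>T. card {A \<in> ?F. A x = t})" by simp
  \<comment> \<open>After multiplication by all the factorials, the choice \<open>t\<close>
    contributes the weight \<open>c t\<close>, because
    \<open>fact (c t) = c t * fact (c t - 1)\<close>. If \<open>c t = 0\<close>, both sides vanish,
    since \<open>t\<close> may not occur at all.\<close>
  have fix1: "card {A \<in> ?F. A x = t} * (\<Prod>s\<in>T. fact (c s)) = c t * fact (card S)"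
    if t: "t \<in> T" for t
  proof (cases "c t = 0")
    case True
    have none: "{A \<in> ?F. A x = t} = {}"
    proof -
      have "card {p \<in> insert x S. A p = t} > 0" if "A x = t" for A
        using that insert.hyps by (auto simp: card_gt_0_iff)
      then show ?thesis using True t by (fastforce simp: fibre_funs_def)
    qed
    show ?thesis by (simp only: none True card.empty mult_0)
  next
    case False
    have fib: "card {p \<in> {x}. t = s} = (if s = t then 1 else 0)" for s by simp
    define d where "d = (\<lambda>s. c s - (if s = t then 1 else 0))"
    have "bij_betw (\<lambda>A. restrict A (insert x S - {x})) {A \<in> ?F. \<forall>p\<in>{x}. A p = t}
            (fibre_funs (insert x S - {x}) T (\<lambda>s. c s - card {p \<in> {x}. t = s}))"
    proof (rule bij_betw_fibre_funs_restrict)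
      show "card {p \<in> {x}. t = s} \<le> c s" for s
        unfolding fib using False by simp
    qed (use insert.hyps t in auto)
    moreover have "insert x S - {x} = S" using insert.hyps by auto
    ultimately have card: "card {A \<in> ?F. A x = t} = card (fibre_funs S T d)"
      unfolding fib d_def[symmetric] by (auto dest: bij_betw_same_card)
    have "sum c T = c t + sum c (T - {t})" "sum d T = d t + sum d (T - {t})"
      using assms(1) t by (auto simp: sum.remove)
    moreover have "sum d (T - {t}) = sum c (T - {t})"
      by (rule sum.cong) (auto simp: d_def)
    moreover have "d t = c t - 1" by (simp add: d_def)
    ultimately have "sum d T = card S"
      using insert.prems insert.hyps False by simp
    then have IH: "card (fibre_funs S T d) * (\<Prod>s\<in>T. fact (d s)) = fact (card S)"
      by (rule insert.IH)
    have "(\<Prod>s\<in>T - {t}. fact (d s)) = (\<Prod>s\<in>T - {t}. fact (c s) :: nat)"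
      by (rule prod.cong) (auto simp: d_def)
    moreover have "fact (c t) = c t * (fact (d t) :: nat)"
      using False by (simp add: d_def fact_reduce)
    ultimately have "(\<Prod>s\<in>T. fact (c s)) = c t * (\<Prod>s\<in>T. fact (d s) :: nat)"
      using assms(1) t by (simp add: prod.remove)
    then show ?thesis using IH by (simp add: card mult.left_commute)
  qed
  \<comment> \<open>The weights \<open>c t\<close> add up to \<open>card (insert x S)\<close>, which
    extends \<open>fact (card S)\<close> to the next factorial.\<close>
  have "card ?F * (\<Prod>s\<in>T. fact (c s)) = (\<Sum>t\<in>T. c t * fact (card S))"
    unfolding split sum_distrib_right by (rule sum.cong) (auto simp: fix1)
  also have "\<dots> = fact (card (insert x S))"
    using insert by (simp flip: sum_distrib_right)
  finally show ?case .
qed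

text \<open>Quotient of two multinomial coefficients, again without division. As \<open>g\<close> is
  injective, each symbol it uses loses exactly one copy, so \<open>fact k\<close> drops to
  \<open>fact (k - 1)\<close> and yields one factor \<open>k\<close> per prescribed cell.\<close>

lemma card_fibre_funs_const_fixed:
  assumes T: "finite T" and S: "finite S" "card S = k * card T"
    and L: "L \<subseteq> S" "g \<in> L \<rightarrow> T" "inj_on g L"
  shows "card {A \<in> fibre_funs S T (\<lambda>_. k). \<forall>p\<in>L. A p = g p} * fact (card S)
           = k ^ card L * fact (card S - card L) * card (fibre_funs S T (\<lambda>_. k))"
proof -
  define d where "d = (\<lambda>s. card {p \<in> L. g p = s})"
  have finL: "finite L" using S L finite_subset by blast
  have d: "d s = (if s \<in> g ` L then 1 else 0)" for s
    unfolding d_def by (rule card_fibre_inj_on[OF L(3)])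
  have gT: "g ` L \<subseteq> T" using L by auto
  have sumd: "sum d T = card L"
  proof -
    have "sum d T = card (g ` L)"
      using T gT by (simp add: d sum.If_cases Int_absorb1 flip: sum.inter_restrict)
    then show ?thesis using L(3) by (simp add: card_image)
  qed
  \<comment> \<open>Each \<open>d s\<close> is 0 or 1, so only \<open>k = 0\<close> could fail; then
    \<open>S\<close> is empty and hence so is \<open>L\<close>.\<close>
  have kd: "d s \<le> k" for s
  proof (cases "k = 0")
    case True
    then have "L = {}" using S L by auto
    then show ?thesis by (simp add: d)
  qed (simp add: d)
  have card: "card {A \<in> fibre_funs S T (\<lambda>_. k). \<forall>p\<in>L. A p = g p}
      = card (fibre_funs (S - L) T (\<lambda>s. k - d s))" (is "?a = ?b")
    unfolding d_def using kd S L
    by (intro bij_betw_same_card[OF bij_betw_fibre_funs_restrict]) (auto simp: d_def)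
  have "(\<Sum>s\<in>T. k - d s) = card (S - L)"
    using kd S L finL sumd by (simp add: sum_subtractf_nat card_Diff_subset mult.commute)
  then have "?b * (\<Prod>s\<in>T. fact (k - d s)) = fact (card (S - L))"
    using S by (intro card_fibre_funs T) auto
  moreover have "card (S - L) = card S - card L"
    using L finL by (simp add: card_Diff_subset)
  ultimately have 1: "?a * (\<Prod>s\<in>T. fact (k - d s)) = fact (card S - card L)"
    by (simp add: card)
  have 2: "card (fibre_funs S T (\<lambda>_. k)) * (\<Prod>s\<in>T. fact k) = fact (card S)"
    using S by (intro card_fibre_funs T) auto
  have "(\<Prod>s\<in>T. fact k) = (\<Prod>s\<in>T. k ^ d s * fact (k - d s) :: nat)"
  proof (intro prod.cong refl)
    fix s
    show "fact k = k ^ d s * (fact (k - d s) :: nat)"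
      using kd[of s] by (cases "s \<in> g ` L") (simp_all add: d fact_reduce)
  qed
  also have "\<dots> = k ^ card L * (\<Prod>s\<in>T. fact (k - d s))"
    by (simp add: prod.distrib sumd flip: power_sum)
  finally have 3: "(\<Prod>s\<in>T. fact k) = k ^ card L * (\<Prod>s\<in>T. fact (k - d s) :: nat)" .
  show ?thesis
    unfolding 2[symmetric] 3 1[symmetric] by (simp add: algebra_simps)
qed

text \<open>The situation once a consecutive line has been removed from a square of side
  \<open>Suc k\<close>: each symbol has \<open>k\<close> copies left. The exact proportion is
  \<open>k ^ k * fact (k * k) / fact (k * Suc k)\<close>, and the last \<open>k\<close> factors of
  the denominator are each at least \<open>k * k\<close>.\<close>

lemma card_fibre_funs_const_fixed_le:
  assumes T: "finite T" "card T = Suc k" and S: "finite S" "card S = k * Suc k"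
    and L: "L \<subseteq> S" "g \<in> L \<rightarrow> T" "inj_on g L" "card L = k"
  shows "card {A \<in> fibre_funs S T (\<lambda>_. k). \<forall>p\<in>L. A p = g p} * k ^ k
           \<le> card (fibre_funs S T (\<lambda>_. k))"
proof (cases "k = 0")
  case True
  then show ?thesis
    using finite_fibre_funs[OF S(1) T(1)] by (simp add: card_mono)
next
  case False
  let ?a = "card {A \<in> fibre_funs S T (\<lambda>_. k). \<forall>p\<in>L. A p = g p}"
  let ?b = "card (fibre_funs S T (\<lambda>_. k))"
  have prod_le: "fact m * m ^ j \<le> (fact (m + j) :: nat)" for m j :: nat
  proof (induction j)
    case (Suc j)
    have "fact m * m ^ Suc j = m * (fact m * m ^ j)" by simp
    also have "\<dots> \<le> Suc (m + j) * fact (m + j)" using Suc by (intro mult_mono) auto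
    finally show ?case by simp
  qed simp
  have eq: "?a * fact (k * Suc k) = k ^ k * fact (k * k) * ?b"
    using card_fibre_funs_const_fixed[of T S k L g] assms by simp
  have "fact (k * k) * (k * k) ^ k \<le> (fact (k * Suc k) :: nat)"
    using prod_le[of "k * k" k] by (simp add: add.commute)
  then have "?a * (fact (k * k) * (k * k) ^ k) \<le> k ^ k * fact (k * k) * ?b"
    unfolding eq[symmetric] by (rule mult_le_mono2)
  \<comment> \<open>One of the two factors \<open>k ^ k\<close> in \<open>(k * k) ^ k\<close> is
    split off for the cancellation; the other remains as the gain.\<close>
  then have "(k ^ k * fact (k * k)) * (?a * k ^ k) \<le> (k ^ k * fact (k * k)) * ?b"
    by (simp add: power_mult_distrib mult_ac)
  then show ?thesis using False by simp
qed

section \<open>A Bonferroni bound\<close>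

text \<open>Remove from each \<open>E x\<close> its overlaps with the other sets. The remainders
  \<open>D x\<close> are pairwise disjoint, and each has lost at most the fraction
  \<open>card I * \<epsilon>\<close> of \<open>E x\<close>.\<close>

lemma card_UN_ge_of_small_intersections:
  fixes \<epsilon> :: real
  assumes I: "finite I" and fin: "\<And>x. x \<in> I \<Longrightarrow> finite (E x)" and "\<epsilon> \<ge> 0"
    and small: "\<And>x y. x \<in> I \<Longrightarrow> y \<in> I \<Longrightarrow> x \<noteq> y \<Longrightarrow> card (E x \<inter> E y) \<le> \<epsilon> * card (E x)"
  shows "(\<Sum>x\<in>I. real (card (E x))) * (1 - card I * \<epsilon>) \<le> card (\<Union>x\<in>I. E x)"
proof -
  define D where "D x = E x - (\<Union>y\<in>I - {x}. E x \<inter> E y)" for x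
  have "card (E x) * (1 - card I * \<epsilon>) \<le> card (D x)" if x: "x \<in> I" for x
  proof -
    have "real (card (\<Union>y\<in>I - {x}. E x \<inter> E y)) \<le> real (\<Sum>y\<in>I - {x}. card (E x \<inter> E y))"
      unfolding of_nat_le_iff using I by (intro card_UN_le) auto
    also have "\<dots> \<le> (\<Sum>y\<in>I - {x}. \<epsilon> * card (E x))"
      unfolding of_nat_sum using x by (intro sum_mono small) auto
    also have "\<dots> \<le> card I * (\<epsilon> * card (E x))"
      using I \<open>\<epsilon> \<ge> 0\<close> by (auto intro!: mult_right_mono card_mono)
    finally have "real (card (\<Union>y\<in>I - {x}. E x \<inter> E y)) \<le> card I * (\<epsilon> * card (E x))" .
    moreover have "card (E x) \<le> card (D x) + card (\<Union>y\<in>I - {x}. E x \<inter> E y)"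
      unfolding D_def using diff_card_le_card_Diff[of "\<Union>y\<in>I - {x}. E x \<inter> E y" "E x"] fin I x by force
    ultimately show ?thesis by (simp add: algebra_simps)
  qed
  then have "(\<Sum>x\<in>I. card (E x) * (1 - card I * \<epsilon>)) \<le> (\<Sum>x\<in>I. real (card (D x)))"
    by (rule sum_mono)
  also have "\<dots> = real (card (\<Union>x\<in>I. D x))"
    unfolding of_nat_sum[symmetric] of_nat_eq_iff using I fin
    by (intro card_UN_disjoint[symmetric]) (auto simp: D_def)
  also have "\<dots> \<le> card (\<Union>x\<in>I. E x)"
    unfolding of_nat_le_iff using I fin by (intro card_mono) (auto simp: D_def)
  finally show ?thesis by (simp add: sum_distrib_right)
qed

section \<open>Consecutive lines\<close>

(* A pattern (b, d, i) prescribes row i (if b) or column i (otherwise) to be increasing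
   (if d) or decreasing (otherwise). *)

definition pat_line :: "nat \<Rightarrow> bool \<times> bool \<times> nat \<Rightarrow> (nat \<times> nat) set" where
  "pat_line n = (\<lambda>(b, d, i). if b then {i} \<times> {1..n} else {1..n} \<times> {i})"

definition pat_val :: "nat \<Rightarrow> bool \<times> bool \<times> nat \<Rightarrow> nat \<times> nat \<Rightarrow> nat" where
  "pat_val n = (\<lambda>(b, d, i) p. let j = (if b then snd p else fst p) in if d then j else Suc n - j)"

definition pats :: "nat \<Rightarrow> (bool \<times> bool \<times> nat) set" where
  "pats n = UNIV \<times> UNIV \<times> {1..n}"

definition pat_squares :: "nat \<Rightarrow> bool \<times> bool \<times> nat \<Rightarrow> (nat \<times> nat \<Rightarrow> nat) set" where
  "pat_squares n x = {A \<in> equi_squares n. \<forall>p\<in>pat_line n x. A p = pat_val n x p}"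

lemma equi_squares_eq: "equi_squares n = fibre_funs ({1..n} \<times> {1..n}) {1..n} (\<lambda>_. n)"
  by (simp add: equi_squares_def fibre_funs_def)

lemma finite_equi_squares: "finite (equi_squares n)"
  unfolding equi_squares_eq by (intro finite_fibre_funs) auto

lemma finite_pat_squares: "finite (pat_squares n x)"
  unfolding pat_squares_def using finite_equi_squares by simp

lemma card_pats: "finite (pats n)" "card (pats n) = 4 * n"
  by (auto simp: pats_def card_cartesian_product)

lemma map_upt_eq_increasing_iff:
  "map f [1..<Suc n] = [1..<Suc n] \<longleftrightarrow> (\<forall>j\<in>{1..n}. f j = j)"
  using map_eq_conv[of f "[1..<Suc n]" "\<lambda>j. j"]
  by (simp del: upt_Suc add: atLeastLessThanSuc_atLeastAtMost)

lemma map_upt_eq_decreasing_iff: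
  "map f [1..<Suc n] = rev [1..<Suc n] \<longleftrightarrow> (\<forall>j\<in>{1..n}. f j = Suc n - j)"
proof -
  have "rev [1..<Suc n] = map (\<lambda>j. Suc n - j) [1..<Suc n]"
    by (rule nth_equalityI) (auto simp del: upt_Suc simp: rev_nth)
  then show ?thesis by (auto simp del: upt_Suc)
qed

text \<open>Brings quantification over patterns into the row-or-column form used by
  \<open>consecutive_squares\<close>.\<close>

lemma bex_pats:
  "(\<exists>x\<in>pats n. P x) \<longleftrightarrow>
     (\<exists>i\<in>{1..n}. P (True, True, i) \<or> P (True, False, i)) \<or>
     (\<exists>j\<in>{1..n}. P (False, True, j) \<or> P (False, False, j))"
  unfolding pats_def by (auto simp: UNIV_bool)

lemma consecutive_squares_eq: "consecutive_squares n = (\<Union>x\<in>pats n. pat_squares n x)"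
proof -
  have "(\<Union>x\<in>pats n. pat_squares n x)
      = {A \<in> equi_squares n. \<exists>x\<in>pats n. \<forall>p\<in>pat_line n x. A p = pat_val n x p}"
    unfolding pat_squares_def by blast
  also have "\<dots> = consecutive_squares n"
    unfolding consecutive_squares_def consecutive_line_def square_row_def square_col_def
      map_upt_eq_increasing_iff map_upt_eq_decreasing_iff bex_pats
    by (simp add: pat_line_def pat_val_def)
  finally show ?thesis ..
qed

text \<open>Collects what the counting lemmas require of a prescription; injectivity records that a
  consecutive line has distinct entries.\<close>

lemma pat_line:
  assumes "x \<in> pats n"
  shows "pat_line n x \<subseteq> {1..n} \<times> {1..n}" "card (pat_line n x) = n" "finite (pat_line n x)"
    "pat_val n x \<in> pat_line n x \<rightarrow> {1..n}" "inj_on (pat_val n x) (pat_line n x)"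
proof -
  obtain b d i where x: "x = (b, d, i)" by (metis prod_cases3)
  have "i \<in> {1..n}" using assms by (simp add: x pats_def)
  then show "pat_line n x \<subseteq> {1..n} \<times> {1..n}" "card (pat_line n x) = n" "finite (pat_line n x)"
    "pat_val n x \<in> pat_line n x \<rightarrow> {1..n}" "inj_on (pat_val n x) (pat_line n x)"
    by (cases b; cases d; auto simp: x pat_line_def pat_val_def card_cartesian_product inj_on_def)+
qed

section \<open>Counting squares with one or two prescribed lines\<close>

lemma card_pat_squares:
  assumes "x \<in> pats n"
  shows "card (pat_squares n x) * fact (n\<^sup>2) = n ^ n * fact (n\<^sup>2 - n) * card (equi_squares n)"
  using card_fibre_funs_const_fixed[of "{1..n}" "{1..n} \<times> {1..n}" n "pat_line n x" "pat_val n x"]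
    pat_line[OF assms]
  by (simp add: pat_squares_def equi_squares_eq card_cartesian_product power2_eq_square)

text \<open>A row and a column cross in a single cell, and distinct parallel lines are
  disjoint.\<close>

lemma card_pat_line_Diff:
  assumes xy: "x \<in> pats n" "y \<in> pats n" "pat_line n x \<noteq> pat_line n y"
  shows "n - 1 \<le> card (pat_line n y - pat_line n x)"
proof -
  have "card (pat_line n y \<inter> pat_line n x) \<le> 1"
  proof -
    obtain p where "pat_line n y \<inter> pat_line n x \<subseteq> {p}"
    proof -
      obtain b d i b' d' i' where "x = (b, d, i)" "y = (b', d', i')" by (metis prod_cases3)
      \<comment> \<open>For a row and a column this is the crossing cell; for parallel lines the
        intersection is empty and any cell would do.\<close>
      then have "pat_line n y \<inter> pat_line n x \<subseteq> {if b then (i, i') else (i', i)}"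
        using xy by (auto simp: pat_line_def split: if_splits)
      then show ?thesis using that by blast
    qed
    then have "card (pat_line n y \<inter> pat_line n x) \<le> card {p}" by (intro card_mono) auto
    then show ?thesis by simp
  qed
  then show ?thesis
    using pat_line[OF xy(2)] by (simp add: card_Diff_subset_Int)
qed

text \<open>Bounds the conditional probability of a second pattern given the first. On a common line
  the two directions contradict each other. Otherwise, deleting the first line leaves
  \<open>n - 1\<close> copies of every symbol, and the second pattern still fixes at least
  \<open>n - 1\<close> cells with distinct entries.\<close>

lemma card_pat_squares_Int:
  assumes xy: "x \<in> pats n" "y \<in> pats n" "x \<noteq> y" and n: "n \<ge> 2"
  shows "card (pat_squares n x \<inter> pat_squares n y) * (n - 1) ^ (n - 1) \<le> card (pat_squares n x)"
proof (cases "pat_line n x = pat_line n y")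
  case True
  have "\<exists>p\<in>pat_line n x. pat_val n x p \<noteq> pat_val n y p"
  proof -
    obtain b d i b' d' i' where eq: "x = (b, d, i)" "y = (b', d', i')" by (metis prod_cases3)
    have i: "i \<in> {1..n}" "i' \<in> {1..n}" using xy eq by (auto simp: pats_def)
    \<comment> \<open>A row cannot equal a column: with \<open>n \<ge> 2\<close> it has two cells,
      which would force the index of the column to be both 1 and 2.\<close>
    have "i = i' \<and> b = b'"
    proof (cases b; cases b')
      assume "b" "b'"
      then have "(i, 1) \<in> pat_line n x" using n by (simp add: eq pat_line_def)
      then show ?thesis using \<open>b\<close> \<open>b'\<close> by (simp add: True) (simp add: eq pat_line_def)
    next
      assume "\<not> b" "\<not> b'"
      then have "(1, i) \<in> pat_line n x" using n by (simp add: eq pat_line_def)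
      then show ?thesis using \<open>\<not> b\<close> \<open>\<not> b'\<close> by (simp add: True) (simp add: eq pat_line_def)
    next
      assume "b" "\<not> b'"
      then have "(i, 1) \<in> pat_line n x" "(i, 2) \<in> pat_line n x"
        using n by (simp_all add: eq pat_line_def)
      then show ?thesis using \<open>\<not> b'\<close> by (simp add: True) (simp add: eq pat_line_def)
    next
      assume "\<not> b" "b'"
      then have "(1, i) \<in> pat_line n x" "(2, i) \<in> pat_line n x"
        using n by (simp_all add: eq pat_line_def)
      then show ?thesis using \<open>b'\<close> by (simp add: True) (simp add: eq pat_line_def)
    qed
    then have bi: "b = b'" "i = i'" by auto
    then have "d \<noteq> d'" using xy eq by simp
    \<comment> \<open>The first cell of the line: it receives 1 in one direction and
      \<open>n\<close> in the other.\<close>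
    define p where "p = (if b then (i, 1) else (1, i))"
    have "p \<in> pat_line n x" "pat_val n x p \<noteq> pat_val n y p"
      using n bi \<open>d \<noteq> d'\<close> by (auto simp: p_def eq pat_line_def pat_val_def)
    then show ?thesis by blast
  qed
  then have "pat_squares n x \<inter> pat_squares n y = {}"
    using True by (auto simp: pat_squares_def)
  then show ?thesis by simp
next
  case False
  \<comment> \<open>Parallel lines leave \<open>n\<close> free cells and crossing lines
    \<open>n - 1\<close>; trimming to exactly \<open>n - 1\<close> treats both alike.\<close>
  obtain K where K: "K \<subseteq> pat_line n y - pat_line n x" "card K = n - 1"
    using obtain_subset_with_card_n[OF card_pat_line_Diff[OF xy(1,2) False]] by metis
  let ?S = "{1..n} \<times> {1..n}" and ?L = "pat_line n x" and ?g = "pat_val n x"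
  let ?r = "\<lambda>A. restrict A (?S - ?L)" and ?F = "fibre_funs (?S - ?L) {1..n} (\<lambda>_. n - 1)"
  note L = pat_line[OF xy(1)]
  \<comment> \<open>A consecutive line is a permutation of the symbols, so removing it takes exactly
    one copy of each.\<close>
  have fibre: "card {p \<in> ?L. ?g p = s} = 1" if "s \<in> {1..n}" for s
  proof -
    have "?g ` ?L = {1..n}"
    proof (rule card_subset_eq)
      show "?g ` ?L \<subseteq> {1..n}" using L(4) by blast
      show "card (?g ` ?L) = card {1..n}" using L(2) L(5) by (simp add: card_image)
    qed simp
    then show ?thesis using that card_fibre_inj_on[OF L(5), of s] by simp
  qed
  have "bij_betw ?r (pat_squares n x)
      (fibre_funs (?S - ?L) {1..n} (\<lambda>s. n - card {p \<in> ?L. ?g p = s}))"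
    unfolding pat_squares_def equi_squares_eq using L n fibre
    by (intro bij_betw_fibre_funs_restrict) auto
  also have "fibre_funs (?S - ?L) {1..n} (\<lambda>s. n - card {p \<in> ?L. ?g p = s}) = ?F"
    by (rule fibre_funs_cong) (simp add: fibre)
  finally have bij: "bij_betw ?r (pat_squares n x) ?F" .
  \<comment> \<open>Forgetting the constraints of \<open>y\<close> outside \<open>K\<close> can only
    enlarge the set, so an injection suffices here.\<close>
  have "card (pat_squares n x \<inter> pat_squares n y)
      \<le> card {B \<in> ?F. \<forall>p\<in>K. B p = pat_val n y p}"
  proof (rule card_inj_on_le)
    show "inj_on ?r (pat_squares n x \<inter> pat_squares n y)"
      using bij by (auto simp: bij_betw_def intro: inj_on_subset)
    have "K \<subseteq> ?S" using K pat_line(1)[OF xy(2)] by blast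
    then have "?r A p = pat_val n y p" if "A \<in> pat_squares n y" "p \<in> K" for A p
      using that K by (auto simp: pat_squares_def)
    then show "?r ` (pat_squares n x \<inter> pat_squares n y)
        \<subseteq> {B \<in> ?F. \<forall>p\<in>K. B p = pat_val n y p}"
      using bij by (auto dest: bij_betwE)
    show "finite {B \<in> ?F. \<forall>p\<in>K. B p = pat_val n y p}"
      using finite_fibre_funs[of "?S - ?L" "{1..n}"] by simp
  qed
  also have "\<dots> * (n - 1) ^ (n - 1) \<le> card ?F"
  proof (rule card_fibre_funs_const_fixed_le)
    show "card (?S - ?L) = (n - 1) * Suc (n - 1)"
      using L n by (simp add: card_Diff_subset card_cartesian_product algebra_simps)
    show "K \<subseteq> ?S - ?L" "pat_val n y \<in> K \<rightarrow> {1..n}" "inj_on (pat_val n y) K" "card K = n - 1"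
      using K pat_line[OF xy(2)] by (auto intro: inj_on_subset)
  qed (use n in auto)
  also have "card ?F = card (pat_squares n x)"
    using bij by (simp add: bij_betw_same_card)
  finally show ?thesis by simp
qed

section \<open>Bounds on the probability and passage to the limit\<close>

text \<open>Needed for \<open>pmf_of_set\<close> to be the uniform distribution. An empty set would
  make the multinomial identity equate 0 with a factorial.\<close>

lemma equi_squares_nonempty: "equi_squares n \<noteq> {}"
proof -
  have "card (equi_squares n) * (\<Prod>s\<in>{1..n}. fact n) = fact (n * n)"
    using card_fibre_funs[of "{1..n}" "{1..n} \<times> {1..n}" "\<lambda>_. n"]
    by (simp add: equi_squares_eq card_cartesian_product)
  then show ?thesis by (metis card.empty fact_nonzero mult_0)
qed

lemma prob_consecutive_squares_bounds:
  fixes n :: nat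
  defines "P \<equiv> measure_pmf.prob (pmf_of_set (equi_squares n)) (consecutive_squares n)"
    and "Q \<equiv> 4 * real n ^ (n + 1) * fact (n\<^sup>2 - n) / fact (n\<^sup>2)"
  assumes n: "n \<ge> 2"
  shows "P \<le> Q" "Q * (1 - 4 * real n / real (n - 1) ^ (n - 1)) \<le> P"
proof -
  define N where "N = real (card (equi_squares n))"
  define \<epsilon> where "\<epsilon> = 1 / real (n - 1) ^ (n - 1)"
  have N: "N > 0"
    using equi_squares_nonempty finite_equi_squares by (simp add: N_def card_gt_0_iff)
  have "equi_squares n \<inter> consecutive_squares n = consecutive_squares n"
    by (auto simp: consecutive_squares_def)
  then have P: "P = card (\<Union>x\<in>pats n. pat_squares n x) / N"
    unfolding P_def N_def
    by (simp add: measure_pmf_of_set equi_squares_nonempty finite_equi_squares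
        consecutive_squares_eq)
  \<comment> \<open>All patterns have the same exact probability, so the \<open>4 * n\<close> of
    them together contribute \<open>Q\<close>.\<close>
  have "real (card (pat_squares n x)) = real n ^ n * fact (n\<^sup>2 - n) / fact (n\<^sup>2) * N"
    if "x \<in> pats n" for x
    using arg_cong[OF card_pat_squares[OF that], of real] by (simp add: N_def field_simps)
  then have "(\<Sum>x\<in>pats n. real (card (pat_squares n x)))
      = card (pats n) * (real n ^ n * fact (n\<^sup>2 - n) / fact (n\<^sup>2) * N)"
    by simp
  then have sum: "(\<Sum>x\<in>pats n. real (card (pat_squares n x))) = Q * N"
    by (simp add: card_pats Q_def)
  \<comment> \<open>The union bound; the matching lower bound below uses \<open>\<epsilon>\<close>
    as the bound on conditional probabilities.\<close>
  have "real (card (\<Union>x\<in>pats n. pat_squares n x)) \<le> Q * N"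
    unfolding sum[symmetric] of_nat_sum[symmetric] of_nat_le_iff
    by (intro card_UN_le card_pats)
  then show "P \<le> Q" using N by (simp add: P divide_le_eq)
  have "card (pat_squares n x \<inter> pat_squares n y) \<le> \<epsilon> * card (pat_squares n x)"
    if "x \<in> pats n" "y \<in> pats n" "x \<noteq> y" for x y
  proof -
    have "real (card (pat_squares n x \<inter> pat_squares n y) * (n - 1) ^ (n - 1))
        \<le> real (card (pat_squares n x))"
      unfolding of_nat_le_iff by (rule card_pat_squares_Int[OF that n])
    then show ?thesis using n by (simp add: \<epsilon>_def field_simps)
  qed
  then have "(\<Sum>x\<in>pats n. real (card (pat_squares n x))) * (1 - card (pats n) * \<epsilon>)
      \<le> card (\<Union>x\<in>pats n. pat_squares n x)"
    by (intro card_UN_ge_of_small_intersections card_pats finite_pat_squares)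
      (auto simp: \<epsilon>_def)
  then have "Q * (1 - 4 * n * \<epsilon>) * N \<le> card (\<Union>x\<in>pats n. pat_squares n x)"
    unfolding sum by (simp add: card_pats mult_ac)
  then have "Q * (1 - 4 * n * \<epsilon>) \<le> P" using N by (simp add: P le_divide_eq)
  then show "Q * (1 - 4 * real n / real (n - 1) ^ (n - 1)) \<le> P" by (simp add: \<epsilon>_def)
qed

theorem corollary1p1p1:
  shows "(\<lambda>n::nat. measure_pmf.prob (pmf_of_set (equi_squares n)) (consecutive_squares n))
           \<sim>[at_top]
         (\<lambda>n::nat. 4 * real n ^ (n + 1) * fact (n\<^sup>2 - n) / fact (n\<^sup>2) :: real)"
    (is "?P \<sim>[at_top] ?Q")
proof (rule asymp_equivI')
  have lim: "(\<lambda>n. 1 - 4 * real n / real (n - 1) ^ (n - 1)) \<longlonglongrightarrow> 1"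
  \<comment> \<open>Shifting the index by one removes the truncated subtraction \<open>n - 1\<close>
    before the limit is computed.\<close>
  proof (rule LIMSEQ_offset[where k = 1])
    have "(\<lambda>n. 1 - 4 * real (n + 1) / real n ^ n) \<longlonglongrightarrow> 1"
      by real_asymp
    then show "(\<lambda>n. 1 - 4 * real (n + 1) / real (n + 1 - 1) ^ (n + 1 - 1)) \<longlonglongrightarrow> 1"
      by simp
  qed
  have Q: "?Q n > 0" if "n \<ge> 2" for n using that by simp
  \<comment> \<open>Dividing both bounds by the positive \<open>?Q n\<close> squeezes the ratio
    between the correction factor and 1.\<close>
  show "(\<lambda>n. ?P n / ?Q n) \<longlonglongrightarrow> 1"
  proof (rule tendsto_sandwich[OF _ _ lim tendsto_const])
    show "\<forall>\<^sub>F n in at_top. 1 - 4 * real n / real (n - 1) ^ (n - 1) \<le> ?P n / ?Q n"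
      using eventually_ge_at_top[of 2]
    proof eventually_elim
      case (elim n)
      then show ?case
        using prob_consecutive_squares_bounds(2)[OF elim] Q[OF elim]
        by (subst pos_le_divide_eq) (auto simp only: mult.commute)
    qed
    show "\<forall>\<^sub>F n in at_top. ?P n / ?Q n \<le> 1"
      using eventually_ge_at_top[of 2]
    proof eventually_elim
      case (elim n)
      then show ?case
        using prob_consecutive_squares_bounds(1)[OF elim] Q[OF elim]
        by (subst pos_divide_le_eq) (auto simp only: mult_1)
    qed
  qed
qed

end
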